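(* Let $n^{(1)}=n^{(L)}=d$, let $T>0$, let the activation functions $g^{(\ell)}:\mathbb{R}\to\mathbb{R}$, $\ell=2,\dots,L$, be globally Lipschitz, let $z=(z_1,\dots,z_N)\in L^2((0,T),\mathbb{R}^{dN})$ be given reference trajectories and $z_0^1,\dots,z_0^N\in\mathbb{R}^d$ given initial values. Suppose that $W_u^{i,j}$ is weakly continuous for all $i,j=1,\dots,N$ and that $g^{(L)}(0)=0$. Then there exists a minimizer for the parameter identification problem, i.e. there is $u^*\in\mathcal{U}_{\mathrm{ad}}:=[-1,1]^K$ such that $$J(x(u^* );z)=\min_{u\in\mathcal{U}_{\mathrm{ad}}}J(x(u);z),\qquad J(x;z)=\frac12\int_0^T\|z(t)-x(t)\|^2\,dt,$$ where $x(u)$ denotes the solution of $$\frac{d}{dt}x_i=\sum_{j=1}^N W_u^{i,j}(x_j-x_i),\qquad x_i(0)=z_0^i,\qquad i=1,\dots,N,\qquad t\in[0,T].$$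
   Context: Feed-forward artificial neural network (NN): fix an integer $L\ge 2$, layer sizes $n^{(1)},\dots,n^{(L)}\in\mathbb{N}$, activation functions $g^{(\ell)}:\mathbb{R}\to\mathbb{R}$ for $\ell=2,\dots,L$, and weights $u^{(\ell)}_{j,k}\in\mathbb{R}$ for $\ell=1,\dots,L-1$. For an input $\xi\in\mathbb{R}^{n^{(1)}}$ put - input layer: $a_1^{(1)}=1$, $a_k^{(1)}=\xi_{k-1}$ for $k\in\{2,\dots,n^{(1)}+1\}$; - hidden layers: $a_1^{(\ell)}=1$, $a_k^{(\ell)}=g^{(\ell)}\big(\sum_{j=1}^{n^{(\ell-1)}+1}u^{(\ell-1)}_{j,k}a_j^{(\ell-1)}\big)$ for $\ell\in\{2,\dots,L-1\}$, $k\in\{2,\dots,n^{(\ell)}+1\}$; - output layer: $a_k^{(L)}=g^{(L)}\big(\sum_{j=1}^{n^{(L-1)}+1}u^{(L-1)}_{j,k}a_j^{(L-1)}\big)$ for $k\in\{1,\dots,n^{(L)}\}$. All weights are collected in one vector $u\in\mathbb{R}^K$, where $K$ is the total number of weights. With $n^{(1)}=n^{(L)}=d$, the network defines a map $W_u:\mathbb{R}^d\to\mathbb{R}^d$, $\xi\mapsto(a_1^{(L)},\dots,a_d^{(L)})$. Interaction terms: there are $N$ agents in $\mathbb{R}^d$. All agents are driven by the same network; the indices $i,j$ only record which pairs interact. For each pair $(i,j)$, $W_u^{i,j}:\mathbb{R}^d\to\mathbb{R}^d$ is either $W_u$, or identically zero, or the output map $W_{\hat u}$ of the feed-forward network with the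 same layer sizes $n^{(1)},\dots,n^{(L)}$ and the same activation functions $g^{(2)},\dots,g^{(L)}$, but with a fixed weight vector $\hat u\in\mathbb{R}^K$ (possibly depending on $(i,j)$) that does not depend on $u$. Under the Lipschitz assumption the initial value problem has, for each $u\in\mathbb{R}^K$, a unique solution $x(u)\in C^1([0,T],\mathbb{R}^{dN})\subset H^1([0,T],\mathbb{R}^{dN})$. "Weakly continuous" means: whenever $x_n\rightharpoonup x$ weakly in $H^1([0,T],\mathbb{R}^{dN})$ and $u_n\to u$ in $\mathbb{R}^K$, one has $W^{i,j}_{u_n}(x_{n,j}-x_{n,i})\rightharpoonup W^{i,j}_u(x_j-x_i)$ weakly in $L^2((0,T),\mathbb{R}^d)$. The norm $\|\cdot\|$ in $J$ is the Euclidean norm. *)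

theory Defs
  imports "HOL-Analysis.Analysis"
begin

section \<open>Feed-forward networks\<close>

text \<open>
  A weight vector is a function of the triples \<open>(l, j, k)\<close>, standing for the weight
  \<open>u\<close> with layer index \<open>l\<close> from node \<open>j\<close> of layer \<open>l\<close> to node \<open>k\<close> of layer \<open>l + 1\<close>.
  Node 1 of each hidden layer is the constant bias node and receives no weights. The space
  of weight vectors, with \<open>K = card (weight_indices L n)\<close>, consists of the functions that are
  \<open>undefined\<close> outside this finite index set.
\<close>

type_synonym weights = "nat \<times> nat \<times> nat \<Rightarrow> real"

definition weight_indices :: "nat \<Rightarrow> (nat \<Rightarrow> nat) \<Rightarrow> (nat \<times> nat \<times> nat) set" where
  "weight_indices L n =
     {(l, j, k). l \<in> {1..L - 1} \<and> j \<in> {1..n l + 1} \<and>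
        k \<in> (if l = L - 1 then {1..n L} else {2..n (l + 1) + 1})}"

definition weight_space :: "nat \<Rightarrow> (nat \<Rightarrow> nat) \<Rightarrow> weights set" where
  "weight_space L n = weight_indices L n \<rightarrow>\<^sub>E UNIV"

definition admissible_weights :: "nat \<Rightarrow> (nat \<Rightarrow> nat) \<Rightarrow> weights set" where
  "admissible_weights L n = weight_indices L n \<rightarrow>\<^sub>E {-1..1}"

definition weights_converge ::
    "nat \<Rightarrow> (nat \<Rightarrow> nat) \<Rightarrow> (nat \<Rightarrow> weights) \<Rightarrow> weights \<Rightarrow> bool" where
  "weights_converge L n us u \<longleftrightarrow>
     range us \<subseteq> weight_space L n \<and> u \<in> weight_space L n \<and>
     (\<forall>w\<in>weight_indices L n. (\<lambda>m. us m w) \<longlonglongrightarrow> u w)"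

text \<open>\<open>activation L n g u \<xi> l k\<close> is the value at node \<open>k\<close> of layer \<open>l\<close>; layers are counted
  from 1, so the equation for layer 0 is irrelevant.\<close>

fun activation :: "nat \<Rightarrow> (nat \<Rightarrow> nat) \<Rightarrow> (nat \<Rightarrow> real \<Rightarrow> real) \<Rightarrow> weights \<Rightarrow> (nat \<Rightarrow> real) \<Rightarrow>
    nat \<Rightarrow> nat \<Rightarrow> real" where
  "activation L n g u \<xi> 0 k = 0"
| "activation L n g u \<xi> (Suc 0) k = (if k = 1 then 1 else \<xi> (k - 1))"
| "activation L n g u \<xi> (Suc (Suc l)) k =
     (if k = 1 \<and> Suc (Suc l) < L then 1
      else g (Suc (Suc l))
        (\<Sum>j = 1..n (Suc l) + 1. u (Suc l, j, k) * activation L n g u \<xi> (Suc l) j))"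

text \<open>\<open>pos\<close> numbers the coordinates by \<open>1, \<dots>, CARD('d)\<close>; it translates between the
  coordinates of a vector and the numbered nodes of the input and output layers.\<close>

definition network_map :: "('d \<Rightarrow> nat) \<Rightarrow> nat \<Rightarrow> (nat \<Rightarrow> nat) \<Rightarrow> (nat \<Rightarrow> real \<Rightarrow> real) \<Rightarrow>
    weights \<Rightarrow> real^'d \<Rightarrow> real^'d" where
  "network_map pos L n g u \<xi> = (\<chi> c. activation L n g u (\<lambda>m. \<xi> $ inv pos m) L (pos c))"

section \<open>Square-integrable and Sobolev functions on an interval\<close>

text \<open>Both spaces consist of functions rather than of classes modulo null sets; their norms are
  therefore seminorms, and a functional bounded by such a seminorm respects equality almost
  everywhere.\<close>

definition L2 :: "real \<Rightarrow> (real \<Rightarrow> 'a::euclidean_space) set" where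
  "L2 T = {f \<in> borel_measurable (lebesgue_on {0<..<T}).
     integrable (lebesgue_on {0<..<T}) (\<lambda>t. (norm (f t))\<^sup>2)}"

definition L2_norm :: "real \<Rightarrow> (real \<Rightarrow> 'a::euclidean_space) \<Rightarrow> real" where
  "L2_norm T f = sqrt (LINT t|lebesgue_on {0<..<T}. (norm (f t))\<^sup>2)"

definition test_function :: "real \<Rightarrow> (real \<Rightarrow> real) \<Rightarrow> bool" where
  "test_function T \<phi> \<longleftrightarrow>
     (\<forall>m t. (deriv ^^ m) \<phi> field_differentiable at t) \<and>
     compact (closure {t. \<phi> t \<noteq> 0}) \<and> closure {t. \<phi> t \<noteq> 0} \<subseteq> {0<..<T}"

definition has_weak_derivative ::
    "real \<Rightarrow> (real \<Rightarrow> 'a::euclidean_space) \<Rightarrow> (real \<Rightarrow> 'a) \<Rightarrow> bool" where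
  "has_weak_derivative T f f' \<longleftrightarrow>
     (\<forall>\<phi>. test_function T \<phi> \<longrightarrow>
        (LINT t|lebesgue_on {0<..<T}. deriv \<phi> t *\<^sub>R f t) =
          - (LINT t|lebesgue_on {0<..<T}. \<phi> t *\<^sub>R f' t))"

definition H1 :: "real \<Rightarrow> (real \<Rightarrow> 'a::euclidean_space) set" where
  "H1 T = {f \<in> L2 T. \<exists>f'\<in>L2 T. has_weak_derivative T f f'}"

definition weak_derivative :: "real \<Rightarrow> (real \<Rightarrow> 'a::euclidean_space) \<Rightarrow> real \<Rightarrow> 'a" where
  "weak_derivative T f = (SOME f'. f' \<in> L2 T \<and> has_weak_derivative T f f')"

definition H1_norm :: "real \<Rightarrow> (real \<Rightarrow> 'a::euclidean_space) \<Rightarrow> real" where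
  "H1_norm T f = sqrt ((L2_norm T f)\<^sup>2 + (L2_norm T (weak_derivative T f))\<^sup>2)"

definition bounded_functional ::
    "(real \<Rightarrow> 'a::real_vector) set \<Rightarrow> ((real \<Rightarrow> 'a) \<Rightarrow> real) \<Rightarrow>
     ((real \<Rightarrow> 'a) \<Rightarrow> real) \<Rightarrow> bool" where
  "bounded_functional V p F \<longleftrightarrow>
     (\<forall>f\<in>V. \<forall>h\<in>V. F (\<lambda>t. f t + h t) = F f + F h) \<and>
     (\<forall>c. \<forall>f\<in>V. F (\<lambda>t. c *\<^sub>R f t) = c * F f) \<and>
     (\<exists>C. \<forall>f\<in>V. \<bar>F f\<bar> \<le> C * p f)"

definition weakly_converges ::
    "(real \<Rightarrow> 'a::real_vector) set \<Rightarrow> ((real \<Rightarrow> 'a) \<Rightarrow> real) \<Rightarrow>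
     (nat \<Rightarrow> real \<Rightarrow> 'a) \<Rightarrow> (real \<Rightarrow> 'a) \<Rightarrow> bool" where
  "weakly_converges V p fs f \<longleftrightarrow>
     range fs \<subseteq> V \<and> f \<in> V \<and>
     (\<forall>F. bounded_functional V p F \<longrightarrow> (\<lambda>m. F (fs m)) \<longlonglongrightarrow> F f)"

section \<open>The interacting system\<close>

definition weakly_continuous_interaction ::
    "nat \<Rightarrow> (nat \<Rightarrow> nat) \<Rightarrow> real \<Rightarrow> 'n \<Rightarrow> 'n::finite \<Rightarrow>
     (weights \<Rightarrow> real^'d \<Rightarrow> real^'d) \<Rightarrow> bool" where
  "weakly_continuous_interaction L n T i j V \<longleftrightarrow>
     (\<forall>(xs :: nat \<Rightarrow> real \<Rightarrow> real^'d^'n) x us u.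
        weakly_converges (H1 T) (H1_norm T) xs x \<and> weights_converge L n us u \<longrightarrow>
        weakly_converges (L2 T) (L2_norm T)
          (\<lambda>m t. V (us m) (xs m t $ j - xs m t $ i)) (\<lambda>t. V u (x t $ j - x t $ i)))"

definition solves_system ::
    "real \<Rightarrow> ('n \<Rightarrow> 'n \<Rightarrow> weights \<Rightarrow> real^'d \<Rightarrow> real^'d) \<Rightarrow> real^'d^'n \<Rightarrow> weights \<Rightarrow>
     (real \<Rightarrow> real^'d^'n) \<Rightarrow> bool" where
  "solves_system T W z0 u x \<longleftrightarrow>
     (\<forall>i. \<forall>t\<in>{0..T}. ((\<lambda>s. x s $ i) has_vector_derivative
        (\<Sum>j\<in>UNIV. W i j u (x t $ j - x t $ i))) (at t within {0..T})) \<and>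
     (\<forall>i. x 0 $ i = z0 $ i)"

text \<open>The solution is unique only as a function on \<open>[0, T]\<close>, hence the restriction to
  functions that are \<open>undefined\<close> elsewhere.\<close>

definition solution ::
    "real \<Rightarrow> ('n \<Rightarrow> 'n \<Rightarrow> weights \<Rightarrow> real^'d \<Rightarrow> real^'d) \<Rightarrow> real^'d^'n \<Rightarrow> weights \<Rightarrow>
     real \<Rightarrow> real^'d^'n" where
  "solution T W z0 u = (THE x. x \<in> extensional {0..T} \<and> solves_system T W z0 u x)"

definition cost :: "real \<Rightarrow> (real \<Rightarrow> real^'d^'n) \<Rightarrow> (real \<Rightarrow> real^'d^'n) \<Rightarrow> real" where
  "cost T z x = (1/2) * (LINT t|lebesgue_on {0..T}. (norm (z t - x t))\<^sup>2)"

end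

theory Submission
  imports Defs
begin

text \<open>On the compact set of admissible weights, the interaction maps are jointly continuous in the
  weights and the state, and Lipschitz in the state with a constant independent of the weights.
  A Picard iteration in an exponentially weighted uniform norm yields the solution on all of
  \<open>[0, T]\<close>, and the same weight turns the contraction estimate into uniform convergence of
  \<open>x(u\<^sub>m)\<close> to \<open>x(u)\<close> whenever \<open>u\<^sub>m\<close> tends to \<open>u\<close>. Hence the cost is continuous in
  the weights and attains its minimum.\<close>

section \<open>Integral form of an autonomous initial value problem\<close>

text \<open>Integrating \<open>M * exp (K * s)\<close> gives back the same exponential divided by
  \<open>K\<close>. This gain \<open>1 / K\<close>, uniform in \<open>t\<close>, is what lets a
  large weight beat any Lipschitz constant on an interval of any length.\<close>

lemma norm_integral_exp_le:
  fixes h :: "real \<Rightarrow> 'a::euclidean_space"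
  assumes "0 < K" "0 \<le> M" "0 \<le> t" "continuous_on {0..t} h"
    and le: "\<And>s. s \<in> {0..t} \<Longrightarrow> norm (h s) \<le> M * exp (K * s)"
  shows "norm (integral {0..t} h) \<le> M / K * exp (K * t)"
proof -
  have I: "((\<lambda>s. M * exp (K * s)) has_integral (M / K * exp (K * t) - M / K * exp (K * 0))) {0..t}"
    using assms by (intro fundamental_theorem_of_calculus)
      (auto intro!: derivative_eq_intros simp: has_real_derivative_iff_has_vector_derivative[symmetric])
  have "norm (integral {0..t} h) \<le> integral {0..t} (\<lambda>s. M * exp (K * s))"
    using assms I by (intro integral_norm_bound_integral integrable_continuous_real)
      (auto intro!: continuous_intros has_integral_integrable[OF I])
  also have "\<dots> = M / K * exp (K * t) - M / K"
    by (subst integral_unique[OF I]) simp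
  also have "\<dots> \<le> M / K * exp (K * t)"
    using assms by simp
  finally show ?thesis .
qed

text \<open>Banach's fixed point theorem in the space of bounded continuous functions. The weight
  makes the contraction factor independent of \<open>T\<close>, so no local solutions have to be
  glued together.\<close>

lemma volterra_exists:
  fixes f :: "'a::euclidean_space \<Rightarrow> 'a" and T :: real
  assumes lip: "C-lipschitz_on UNIV f" and T: "0 \<le> T"
  obtains x where "continuous_on {0..T} x"
    "\<And>t. t \<in> {0..T} \<Longrightarrow> x t = x0 + integral {0..t} (\<lambda>s. f (x s))"
proof -
  \<comment> \<open>The contraction factor will be \<open>C / K\<close>, hence at most 1/2; the
    summand 1 keeps \<open>K\<close> positive when \<open>C = 0\<close>.\<close>
  define K where "K = 2 * C + 1"
  have C: "0 \<le> C" using lipschitz_on_nonneg[OF lip] .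
  have K: "0 < K" using C by (simp add: K_def)
  have cf: "continuous_on A (\<lambda>s. f (h s))" if "continuous_on A h" for A :: "real set" and h
    using continuous_on_compose2[OF lipschitz_on_continuous_on[OF lip] that] by simp
  \<comment> \<open>The substitution \<open>y t = exp (- K t) x t\<close> makes the Picard operator a contraction of the
    uniform norm on the whole interval.\<close>
  define P where "P y t = exp (- (K * t)) *\<^sub>R
      (x0 + integral {0..t} (\<lambda>s. f (exp (K * s) *\<^sub>R apply_bcontfun y s)))"
    for y :: "real \<Rightarrow>\<^sub>C 'a" and t
  have cy: "continuous_on A (\<lambda>s. f (exp (K * s) *\<^sub>R apply_bcontfun y s))" for y :: "real \<Rightarrow>\<^sub>C 'a" and A
    by (intro cf continuous_on_scaleR continuous_on_apply_bcontfun continuous_intros)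
  have cP: "continuous_on (cbox 0 T) (P y)" for y
    unfolding P_def cbox_interval
    by (intro continuous_intros indefinite_integral_continuous_1 integrable_continuous_real cy)
  \<comment> \<open>Continuity of \<open>P y\<close> is known on \<open>{0..T}\<close> only.
    Composing with \<open>clamp\<close> extends it by its end values to a bounded continuous
    function on the whole line, so that the iteration stays in one complete space.\<close>
  have "\<exists>h :: real \<Rightarrow>\<^sub>C 'a. \<forall>t. apply_bcontfun h t = P y (clamp 0 T t)" for y
    using continuous_on_cbox_bcontfunE[OF cP] by metis
  then obtain \<Phi> :: "(real \<Rightarrow>\<^sub>C 'a) \<Rightarrow> (real \<Rightarrow>\<^sub>C 'a)" where \<Phi>: "\<And>y t. apply_bcontfun (\<Phi> y) t = P y (clamp 0 T t)"
    by metis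
  have "dist (\<Phi> y) (\<Phi> w) \<le> 1/2 * dist y w" for y w
  proof (rule dist_bound)
    fix r
    define t where "t = clamp 0 T r"
    have t: "0 \<le> t" "t \<le> T"
      using clamp_in_interval[of 0 T r] T by (auto simp: t_def)
    let ?g = "\<lambda>y s. f (exp (K * s) *\<^sub>R apply_bcontfun y s)"
    have le: "norm (?g y s - ?g w s) \<le> (C * dist y w) * exp (K * s)" for s
    proof -
      have "norm (?g y s - ?g w s) \<le> C * norm (exp (K * s) *\<^sub>R apply_bcontfun y s - exp (K * s) *\<^sub>R apply_bcontfun w s)"
        using lipschitz_onD[OF lip] by (simp add: dist_norm)
      also have "\<dots> = C * (exp (K * s) * dist (apply_bcontfun y s) (apply_bcontfun w s))"
        by (simp add: dist_norm flip: scaleR_diff_right)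
      also have "\<dots> \<le> C * (exp (K * s) * dist y w)"
        using C by (intro mult_left_mono dist_bounded) auto
      finally show ?thesis by (simp add: mult_ac)
    qed
    have "P y t - P w t = exp (- (K * t)) *\<^sub>R integral {0..t} (\<lambda>s. ?g y s - ?g w s)"
      by (simp add: P_def integral_diff integrable_continuous_real cy flip: scaleR_diff_right)
    then have "norm (P y t - P w t) = exp (- (K * t)) * norm (integral {0..t} (\<lambda>s. ?g y s - ?g w s))"
      by simp
    also have "\<dots> \<le> exp (- (K * t)) * (C * dist y w / K * exp (K * t))"
      using C K t le by (intro mult_left_mono norm_integral_exp_le continuous_intros cy) auto
    also have "\<dots> = C / K * dist y w"
      by (simp add: exp_minus field_simps)
    also have "\<dots> \<le> 1/2 * dist y w"
      using C by (intro mult_right_mono) (auto simp: K_def field_simps)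
    finally show "dist (apply_bcontfun (\<Phi> y) r) (apply_bcontfun (\<Phi> w) r) \<le> 1/2 * dist y w"
      by (simp add: \<Phi> dist_norm t_def)
  qed
  then obtain y where y: "\<Phi> y = y"
    using banach_fix_type[of "1/2" \<Phi>] by auto
  show ?thesis
  \<comment> \<open>Undoing the substitution cancels the factor \<open>exp (- (K * t))\<close> in
    \<open>P\<close>.\<close>
  proof (rule that[of "\<lambda>t. exp (K * t) *\<^sub>R apply_bcontfun y t"])
    fix t assume t: "t \<in> {0..T}"
    then have "clamp 0 T t = t" by (intro clamp_cancel_cbox) auto
    then have "apply_bcontfun y t = P y t"
      using \<Phi>[of y t] y by simp
    then show "exp (K * t) *\<^sub>R apply_bcontfun y t =
        x0 + integral {0..t} (\<lambda>s. f (exp (K * s) *\<^sub>R apply_bcontfun y s))"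
      by (simp add: P_def flip: exp_add)
  qed (intro continuous_on_scaleR continuous_on_apply_bcontfun continuous_intros)
qed

text \<open>A weighted-norm substitute for Gronwall's inequality: at the maximum of the weighted
  distance, the Lipschitz term contributes at most half of that maximum and is absorbed. The defect
  of the two right-hand sides is measured along \<open>y\<close> alone, and only \<open>f\<close>
  has to be Lipschitz. The case \<open>h = f\<close> is uniqueness.\<close>

lemma volterra_stability:
  fixes f h :: "'a::euclidean_space \<Rightarrow> 'a" and T :: real
  assumes lip: "C-lipschitz_on UNIV f" and ch: "continuous_on UNIV h"
    and cx: "continuous_on {0..T} x" and cy: "continuous_on {0..T} y"
    and x: "\<And>t. t \<in> {0..T} \<Longrightarrow> x t = x0 + integral {0..t} (\<lambda>s. f (x s))"
    and y: "\<And>t. t \<in> {0..T} \<Longrightarrow> y t = x0 + integral {0..t} (\<lambda>s. h (y s))"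
    and t: "t \<in> {0..T}"
  shows "norm (x t - y t) \<le> 2 * exp ((2 * C + 1) * T) * integral {0..T} (\<lambda>s. norm (f (y s) - h (y s)))"
proof -
  define K where "K = 2 * C + 1"
  define E where "E = integral {0..T} (\<lambda>s. norm (f (y s) - h (y s)))"
  have C: "0 \<le> C" using lipschitz_on_nonneg[OF lip] .
  have K: "0 < K" using C by (simp add: K_def)
  have c: "continuous_on {0..T} (\<lambda>s. f (x s))" "continuous_on {0..T} (\<lambda>s. f (y s))"
      "continuous_on {0..T} (\<lambda>s. h (y s))"
    using continuous_on_compose2[OF lipschitz_on_continuous_on[OF lip] cx]
      continuous_on_compose2[OF lipschitz_on_continuous_on[OF lip] cy]
      continuous_on_compose2[OF ch cy] by simp_all
  let ?\<phi> = "\<lambda>s. exp (- (K * s)) * norm (x s - y s)"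
  have "continuous_on {0..T} ?\<phi>"
    by (intro continuous_intros cx cy)
  then obtain r where r: "r \<in> {0..T}" and max: "\<And>s. s \<in> {0..T} \<Longrightarrow> ?\<phi> s \<le> ?\<phi> r"
    using continuous_attains_sup[of "{0..T}" ?\<phi>] t by (auto simp: compact_Icc)
  have sub: "{0..r} \<subseteq> {0..T}" using r by auto
  note c' = c[THEN continuous_on_subset, OF sub]
  have le: "norm (f (x s) - f (y s)) \<le> (C * ?\<phi> r) * exp (K * s)" if "s \<in> {0..r}" for s
  proof -
    have "norm (f (x s) - f (y s)) \<le> C * norm (x s - y s)"
      using lipschitz_onD[OF lip] by (simp add: dist_norm)
    also have "norm (x s - y s) = ?\<phi> s * exp (K * s)"
      by (simp add: exp_minus)
    also have "C * \<dots> \<le> C * (?\<phi> r * exp (K * s))"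
      using C that sub by (intro mult_left_mono mult_right_mono max) auto
    finally show ?thesis by (simp add: mult_ac)
  qed
  \<comment> \<open>Inserting \<open>f (y s)\<close> splits the integrand
    \<open>f (x s) - h (y s)\<close> into a Lipschitz part and the defect along
    \<open>y\<close>.\<close>
  have "x r - y r = integral {0..r} (\<lambda>s. f (x s) - f (y s)) + integral {0..r} (\<lambda>s. f (y s) - h (y s))"
    using x[OF r] y[OF r] c' by (simp add: integral_diff integrable_continuous_real)
  moreover have "norm (integral {0..r} (\<lambda>s. f (x s) - f (y s))) \<le> C * ?\<phi> r / K * exp (K * r)"
    using C K r le by (intro norm_integral_exp_le continuous_intros c') auto
  moreover have "norm (integral {0..r} (\<lambda>s. f (y s) - h (y s))) \<le> integral {0..r} (\<lambda>s. norm (f (y s) - h (y s)))"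
    by (intro integral_norm_bound_integral integrable_continuous_real continuous_intros c') auto
  moreover have "\<dots> \<le> E"
    unfolding E_def using sub
    by (intro integral_subset_le integrable_continuous_real continuous_intros c c') auto
  ultimately have "norm (x r - y r) \<le> C * ?\<phi> r / K * exp (K * r) + E"
    using norm_triangle_ineq[of "integral {0..r} (\<lambda>s. f (x s) - f (y s))"] by smt
  then have "?\<phi> r \<le> exp (- (K * r)) * (C * ?\<phi> r / K * exp (K * r) + E)"
    by (intro mult_left_mono) auto
  also have "\<dots> = C / K * ?\<phi> r + exp (- (K * r)) * E"
    by (simp add: exp_minus field_simps)
  \<comment> \<open>Half of the maximum can now move to the left side, which produces the factor 2
    of the conclusion.\<close>
  also have "\<dots> \<le> 1/2 * ?\<phi> r + 1 * E"
  proof (intro add_mono mult_right_mono)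
    show "C / K \<le> 1/2" using C by (auto simp: K_def field_simps)
    show "0 \<le> E" unfolding E_def
      by (intro integral_nonneg integrable_continuous_real continuous_intros c) auto
  qed (use K r in auto)
  finally have 1: "?\<phi> r \<le> 2 * E" by simp
  have "norm (x t - y t) = exp (K * t) * ?\<phi> t"
    by (simp add: exp_minus)
  also have "\<dots> \<le> exp (K * T) * (2 * E)"
  proof (rule mult_mono)
    show "?\<phi> t \<le> 2 * E" using max[OF t] 1 by (rule order_trans)
  qed (use K t in auto)
  finally show ?thesis by (simp add: K_def E_def mult_ac)
qed

text \<open>Both directions are the fundamental theorem of calculus; from right to left, continuity
  of \<open>x\<close> makes the integrand continuous, and \<open>t = 0\<close> yields the initial
  value.\<close>

lemma volterra_iff_ode:
  fixes f :: "'a::euclidean_space \<Rightarrow> 'a" and T :: real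
  assumes cf: "continuous_on UNIV f" and T: "0 \<le> T"
  shows "(\<forall>t\<in>{0..T}. (x has_vector_derivative f (x t)) (at t within {0..T})) \<and> x 0 = x0 \<longleftrightarrow>
    continuous_on {0..T} x \<and> (\<forall>t\<in>{0..T}. x t = x0 + integral {0..t} (\<lambda>s. f (x s)))"
    (is "?ode \<longleftrightarrow> ?int")
proof
  assume ?ode
  then have d: "\<And>t. t \<in> {0..T} \<Longrightarrow> (x has_vector_derivative f (x t)) (at t within {0..T})" and x0: "x 0 = x0"
    by auto
  have "x t = x0 + integral {0..t} (\<lambda>s. f (x s))" if "t \<in> {0..T}" for t
  proof -
    have "((\<lambda>s. f (x s)) has_integral x t - x 0) {0..t}"
      using that by (intro fundamental_theorem_of_calculus has_vector_derivative_within_subset[OF d]) auto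
    then show ?thesis using x0 by (simp add: integral_unique)
  qed
  moreover have "continuous_on {0..T} x"
    using has_vector_derivative_continuous[OF d] by (simp add: continuous_on_eq_continuous_within)
  ultimately show ?int by blast
next
  assume ?int
  then have cx: "continuous_on {0..T} x"
    and e: "\<And>t. t \<in> {0..T} \<Longrightarrow> x t = x0 + integral {0..t} (\<lambda>s. f (x s))" by auto
  have "continuous_on {0..T} (\<lambda>s. f (x s))"
    using continuous_on_compose2[OF cf cx] by simp
  then have d: "((\<lambda>t. x0 + integral {0..t} (\<lambda>s. f (x s))) has_vector_derivative f (x t)) (at t within {0..T})"
    if "t \<in> {0..T}" for t
    using integral_has_vector_derivative[OF _ that] by (auto intro!: derivative_eq_intros)
  have "(x has_vector_derivative f (x t)) (at t within {0..T})" if "t \<in> {0..T}" for t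
    using that e d[OF that] by (rule has_vector_derivative_transform)
  then show ?ode using e[of 0] T by auto
qed

section \<open>Regularity of feed-forward networks\<close>

lemma lipschitz_on_sum:
  fixes f :: "'i \<Rightarrow> 'a::metric_space \<Rightarrow> 'b::real_normed_vector"
  assumes "\<And>i. i \<in> I \<Longrightarrow> (C i)-lipschitz_on X (f i)"
  shows "(\<Sum>i\<in>I. C i)-lipschitz_on X (\<lambda>x. \<Sum>i\<in>I. f i x)"
  using assms by (induction I rule: infinite_finite_induct) (auto intro: lipschitz_on_add lipschitz_on_constant)

text \<open>The Euclidean distance is at most the sum of the coordinate distances, so the constants
  add up.\<close>

lemma lipschitz_on_vec:
  fixes f :: "'a::metric_space \<Rightarrow> ('b::real_normed_vector)^'n"
  assumes "\<And>i. (C i)-lipschitz_on X (\<lambda>x. f x $ i)"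
  shows "(\<Sum>i\<in>UNIV. C i)-lipschitz_on X f"
proof (rule lipschitz_onI)
  fix x y assume xy: "x \<in> X" "y \<in> X"
  have "dist (f x) (f y) \<le> (\<Sum>i\<in>UNIV. dist (f x $ i) (f y $ i))"
    unfolding dist_vec_def by (rule L2_set_le_sum) auto
  also have "\<dots> \<le> (\<Sum>i\<in>UNIV. C i * dist x y)"
    using xy assms by (intro sum_mono) (auto dest: lipschitz_onD)
  finally show "dist (f x) (f y) \<le> (\<Sum>i\<in>UNIV. C i) * dist x y"
    by (simp add: sum_distrib_right)
qed (rule sum_nonneg, rule lipschitz_on_nonneg[OF assms])

lemma lipschitz_on_vec_nth: "1-lipschitz_on X (\<lambda>x :: ('b::real_normed_vector)^'n. x $ i)"
  by (rule lipschitz_onI) (auto simp: dist_vec_nth_le)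

section \<open>The compact set of admissible weights\<close>

text \<open>Tychonoff's theorem: pinning the coordinates outside \<open>weight_indices\<close> to
  the singleton of \<open>undefined\<close> turns the set into a product of compact sets over all
  triples.\<close>

lemma compact_admissible_weights: "compact (admissible_weights L n)"
proof -
  define S where "S = (\<lambda>w. if w \<in> weight_indices L n then {-1..1} else {undefined :: real})"
  have "admissible_weights L n = PiE UNIV S"
    by (auto simp: admissible_weights_def S_def PiE_def Pi_def extensional_def split: if_splits)
  moreover have "compactin (product_topology (\<lambda>_. euclidean) UNIV) (PiE UNIV S)"
    unfolding compactin_PiE by (simp add: S_def)
  ultimately show ?thesis
    by (simp add: euclidean_product_topology)
qed

lemma admissible_weights_nonempty: "admissible_weights L n \<noteq> {}"
  by (simp add: admissible_weights_def PiE_eq_empty_iff)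

lemma admissible_weights_subset: "admissible_weights L n \<subseteq> weight_space L n"
  unfolding admissible_weights_def weight_space_def by (rule PiE_mono) simp

section \<open>Dependence of the network on weights and input\<close>

text \<open>Induction on the layer, for all nodes at once. Letting weights and input both depend on
  a parameter \<open>p\<close> covers joint continuity as well as the case of fixed weights.\<close>

lemma continuous_on_activation:
  assumes g: "\<And>l. l \<in> {2..L} \<Longrightarrow> continuous_on UNIV (g l)" and "l \<le> L"
    and u: "\<And>w. continuous_on X (\<lambda>p. u p w)" and \<xi>: "\<And>m. continuous_on X (\<lambda>p. \<xi> p m)"
  shows "continuous_on X (\<lambda>p. activation L n g (u p) (\<xi> p) l k)"
  using \<open>l \<le> L\<close>
proof (induction l arbitrary: k)
  case (Suc l)
  show ?case
  proof (cases l)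
    case (Suc l')
    have "continuous_on X (\<lambda>p. g (Suc l)
        (\<Sum>j = 1..n l + 1. u p (l, j, k) * activation L n g (u p) (\<xi> p) l j))"
      using Suc.IH Suc.prems Suc by (intro continuous_on_compose2[OF g] continuous_intros u) auto
    then show ?thesis using Suc by (cases "k = 1 \<and> Suc l < L") auto
  qed (cases "k = 1"; auto intro!: \<xi>)
qed simp

text \<open>The constant precedes the quantifier over \<open>u\<close>: bounds on the single weights
  replace the weights themselves when constants are multiplied from layer to layer.\<close>

lemma lipschitz_on_activation:
  assumes g: "\<And>l. l \<in> {2..L} \<Longrightarrow> \<exists>C. C-lipschitz_on UNIV (g l)" and "l \<le> L"
    and U: "\<And>w. bounded ((\<lambda>u. u w) ` U)" and \<xi>: "\<And>m. 1-lipschitz_on X (\<lambda>x. \<xi> x m)"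
  shows "\<exists>C. \<forall>u\<in>U. C-lipschitz_on X (\<lambda>x. activation L n g u (\<xi> x) l k)"
  using \<open>l \<le> L\<close>
proof (induction l arbitrary: k)
  case 0
  then show ?case by (auto intro!: exI[of _ 0] lipschitz_on_constant)
next
  case (Suc l)
  have const: "1-lipschitz_on X (\<lambda>_. 1 :: real)"
    by (rule lipschitz_on_mono[OF lipschitz_on_constant]) auto
  show ?case
  proof (cases l)
    case 0
    then show ?thesis using \<xi> const by (cases "k = 1") auto
  next
    case (Suc l')
    obtain C where C: "\<And>j u. u \<in> U \<Longrightarrow> (C j)-lipschitz_on X (\<lambda>x. activation L n g u (\<xi> x) l j)"
      using Suc.IH Suc.prems by (metis Suc_leD)
    obtain B where B: "\<And>w u. u \<in> U \<Longrightarrow> \<bar>u w\<bar> \<le> B w"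
      using U unfolding bounded_iff by (metis image_eqI real_norm_def)
    obtain D where D: "D-lipschitz_on UNIV (g (Suc l))"
      using g[of "Suc l"] Suc.prems Suc by auto
    \<comment> \<open>This constant uses the bounds \<open>B\<close> instead of the weights, so it
      is the same for all of \<open>U\<close>.\<close>
    have "(D * (\<Sum>j = 1..n l + 1. B (l, j, k) * C j))-lipschitz_on X
        (\<lambda>x. g (Suc l) (\<Sum>j = 1..n l + 1. u (l, j, k) * activation L n g u (\<xi> x) l j))"
      if "u \<in> U" for u
      using that by (intro lipschitz_on_compose2 lipschitz_on_sum lipschitz_on_cmult_real_upper C B
          lipschitz_on_subset[OF D]) auto
    then have step: "\<exists>D. \<forall>u\<in>U. D-lipschitz_on X
        (\<lambda>x. g (Suc l) (\<Sum>j = 1..n l + 1. u (l, j, k) * activation L n g u (\<xi> x) l j))"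
      by (intro exI ballI)
    have eq: "activation L n g u \<eta> (Suc l) k = (if k = 1 \<and> Suc l < L then 1
        else g (Suc l) (\<Sum>j = 1..n l + 1. u (l, j, k) * activation L n g u \<eta> l j))" for u \<eta>
      using Suc by simp
    show ?thesis
    proof (cases "k = 1 \<and> Suc l < L")
      case True
      show ?thesis unfolding eq if_P[OF True] using const by (intro exI ballI)
    next
      case False
      show ?thesis unfolding eq if_not_P[OF False] by (fact step)
    qed
  qed
qed

lemma continuous_on_network_map:
  assumes "\<And>l. l \<in> {2..L} \<Longrightarrow> continuous_on UNIV (g l)"
    and "\<And>w. continuous_on X (\<lambda>p. u p w)" "continuous_on X \<xi>"
  shows "continuous_on X (\<lambda>p. network_map pos L n g (u p) (\<xi> p))"
  unfolding network_map_def using assms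
  by (intro continuous_on_vec_lambda continuous_on_activation) (auto intro!: continuous_intros)

lemma lipschitz_on_network_map:
  fixes pos :: "'d::finite \<Rightarrow> nat"
  assumes "\<And>l. l \<in> {2..L} \<Longrightarrow> \<exists>C. C-lipschitz_on UNIV (g l)"
    and "\<And>w. bounded ((\<lambda>u. u w) ` U)"
  shows "\<exists>C. \<forall>u\<in>U. C-lipschitz_on UNIV (network_map pos L n g u)"
proof -
  have "\<exists>C. \<forall>u\<in>U. C-lipschitz_on UNIV (\<lambda>\<xi> :: real^'d. activation L n g u (\<lambda>m. \<xi> $ inv pos m) L k)" for k
    by (rule lipschitz_on_activation) (auto intro: assms lipschitz_on_vec_nth)
  then obtain C where "\<And>k u. u \<in> U \<Longrightarrow>
      (C k)-lipschitz_on UNIV (\<lambda>\<xi> :: real^'d. activation L n g u (\<lambda>m. \<xi> $ inv pos m) L k)"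
    by metis
  then have "(\<Sum>c\<in>UNIV. C (pos c))-lipschitz_on UNIV (network_map pos L n g u)" if "u \<in> U" for u
    using that by (intro lipschitz_on_vec) (simp add: network_map_def)
  then show ?thesis by blast
qed

text \<open>The three admissible forms of an interaction are treated by the same two network lemmas
  or are constant. Since \<open>V\<close> is prescribed on the weight space only, everything is
  stated on \<open>A\<close>.\<close>

lemma interaction_regular:
  fixes pos :: "'d::finite \<Rightarrow> nat" and V :: "weights \<Rightarrow> real^'d \<Rightarrow> real^'d"
  assumes g: "\<And>l. l \<in> {2..L} \<Longrightarrow> \<exists>C. C-lipschitz_on UNIV (g l)"
    and V: "(\<forall>u\<in>weight_space L n. V u = network_map pos L n g u)
      \<or> (\<forall>u\<in>weight_space L n. V u = (\<lambda>\<xi>. 0))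
      \<or> (\<exists>uhat\<in>weight_space L n. \<forall>u\<in>weight_space L n. V u = network_map pos L n g uhat)"
  defines "A \<equiv> admissible_weights L n"
  shows "continuous_on (A \<times> UNIV) (\<lambda>(u, \<xi>). V u \<xi>)"
    and "\<exists>C. \<forall>u\<in>A. C-lipschitz_on UNIV (V u)"
proof -
  have cg: "continuous_on UNIV (g l)" if "l \<in> {2..L}" for l
    using g[OF that] by (elim exE lipschitz_on_continuous_on)
  have sub: "u \<in> weight_space L n" if "u \<in> A" for u
    using that admissible_weights_subset unfolding A_def by blast
  have coord: "continuous_on X (\<lambda>u :: weights. u w)" for X w
    by (rule continuous_on_subset[OF continuous_on_product_coordinates]) simp
  have bA: "bounded ((\<lambda>u. u w) ` A)" for w
    unfolding A_def by (intro compact_imp_bounded compact_continuous_image compact_admissible_weights coord)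
  have reg: "continuous_on (A \<times> UNIV) (\<lambda>(u, \<xi>). V u \<xi>) \<and> (\<exists>C. \<forall>u\<in>A. C-lipschitz_on UNIV (V u))"
    if V: "\<And>u. u \<in> A \<Longrightarrow> V u = F u" and F: "continuous_on (A \<times> UNIV) (\<lambda>p. F (fst p) (snd p))"
      "\<exists>C. \<forall>u\<in>A. C-lipschitz_on UNIV (F u)" for F
  proof
    show "continuous_on (A \<times> UNIV) (\<lambda>(u, \<xi>). V u \<xi>)"
      using F(1) by (rule continuous_on_eq) (auto simp: V)
    show "\<exists>C. \<forall>u\<in>A. C-lipschitz_on UNIV (V u)"
      using F(2) by (simp only: V cong: ball_cong)
  qed
  have "continuous_on (A \<times> UNIV) (\<lambda>p :: weights \<times> (real^'d). fst p w)" for w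
    by (rule continuous_on_product_then_coordinatewise) (rule continuous_on_fst, rule continuous_on_id)
  then have net: "continuous_on (A \<times> UNIV) (\<lambda>p. network_map pos L n g (fst p) (snd p))"
    by (intro continuous_on_network_map cg continuous_on_snd continuous_on_id)
  have fixed_net: "continuous_on (A \<times> UNIV) (\<lambda>p. network_map pos L n g uhat (snd p))" for uhat
    by (intro continuous_on_network_map cg continuous_on_const continuous_on_snd continuous_on_id)
  \<comment> \<open>The fixed weights may lie outside the admissible box, but a singleton is
    bounded, so the uniform estimate applies to it.\<close>
  have fixed_lip: "\<exists>C. \<forall>u\<in>A. C-lipschitz_on UNIV (network_map pos L n g uhat)" for uhat
  proof -
    have "\<exists>C. \<forall>u\<in>{uhat}. C-lipschitz_on UNIV (network_map pos L n g u)"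
      by (rule lipschitz_on_network_map[OF g]) simp_all
    then obtain C where "C-lipschitz_on UNIV (network_map pos L n g uhat)"
      unfolding Set.ball_simps by (elim exE conjE)
    then show ?thesis by (intro exI ballI)
  qed
  from V have both: "continuous_on (A \<times> UNIV) (\<lambda>(u, \<xi>). V u \<xi>) \<and> (\<exists>C. \<forall>u\<in>A. C-lipschitz_on UNIV (V u))"
  proof (elim disjE bexE)
    assume "\<forall>u\<in>weight_space L n. V u = network_map pos L n g u"
    then show ?thesis
      by (intro reg[OF _ net lipschitz_on_network_map[OF g bA]]) (simp_all add: sub)
  next
    assume "\<forall>u\<in>weight_space L n. V u = (\<lambda>\<xi>. 0)"
    then have "V u = (\<lambda>u \<xi>. 0) u" if "u \<in> A" for u
      using sub[OF that] by simp
    then show ?thesis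
      by (rule reg) (assumption | intro continuous_on_const exI[of _ 0] ballI lipschitz_on_constant)+
  next
    fix uhat assume "\<forall>u\<in>weight_space L n. V u = network_map pos L n g uhat"
    then show ?thesis
      by (intro reg[OF _ fixed_net fixed_lip]) (simp_all add: sub)
  qed
  from both show "continuous_on (A \<times> UNIV) (\<lambda>(u, \<xi>). V u \<xi>)" by (rule conjunct1)
  from both show "\<exists>C. \<forall>u\<in>A. C-lipschitz_on UNIV (V u)" by (rule conjunct2)
qed

section \<open>Solutions and cost of the interacting system\<close>

lemma has_vector_derivative_vec_iff:
  fixes x :: "real \<Rightarrow> ('b::euclidean_space)^'n"
  shows "(x has_vector_derivative D) (at t within S) \<longleftrightarrow>
    (\<forall>i. ((\<lambda>s. x s $ i) has_vector_derivative D $ i) (at t within S))"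
proof
  assume "(x has_vector_derivative D) (at t within S)"
  then show "\<forall>i. ((\<lambda>s. x s $ i) has_vector_derivative D $ i) (at t within S)"
    using bounded_linear.has_vector_derivative[OF bounded_linear_vec_nth] by blast
next
  assume *: "\<forall>i. ((\<lambda>s. x s $ i) has_vector_derivative D $ i) (at t within S)"
  show "(x has_vector_derivative D) (at t within S)"
    using * unfolding has_vector_derivative_def has_derivative_within
    by (auto intro!: vec_tendstoI bounded_linear_scaleR_left)
qed

text \<open>Collects the coupled equations into one autonomous equation on
  \<open>real^'d^'n\<close>, the form that \<open>volterra_iff_ode\<close> treats.\<close>

lemma solves_system_iff:
  "solves_system T W z0 u x \<longleftrightarrow>
    (\<forall>t\<in>{0..T}. (x has_vector_derivative (\<chi> i. \<Sum>j\<in>UNIV. W i j u (x t $ j - x t $ i))) (at t within {0..T}))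
    \<and> x 0 = z0"
  by (auto simp: solves_system_def has_vector_derivative_vec_iff vec_eq_iff)

text \<open>Justifies the definite description in \<open>solution\<close>: existence is
  \<open>volterra_exists\<close>, uniqueness is \<open>volterra_stability\<close> with equal
  right-hand sides.\<close>

lemma solution_volterra:
  fixes W :: "'n::finite \<Rightarrow> 'n \<Rightarrow> weights \<Rightarrow> real^'d \<Rightarrow> real^'d" and T :: real
  defines "F \<equiv> \<lambda>u x. \<chi> i. \<Sum>j\<in>UNIV. W i j u (x $ j - x $ i)"
  assumes lip: "C-lipschitz_on UNIV (F u)" and T: "0 \<le> T"
  shows "continuous_on {0..T} (solution T W z0 u)"
    and "\<And>t. t \<in> {0..T} \<Longrightarrow> solution T W z0 u t = z0 + integral {0..t} (\<lambda>s. F u (solution T W z0 u s))"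
proof -
  have cF: "continuous_on UNIV (F u)" using lip by (rule lipschitz_on_continuous_on)
  have iff: "solves_system T W z0 u x \<longleftrightarrow>
      continuous_on {0..T} x \<and> (\<forall>t\<in>{0..T}. x t = z0 + integral {0..t} (\<lambda>s. F u (x s)))" for x
    unfolding solves_system_iff volterra_iff_ode[OF cF T, symmetric] by (simp add: F_def)
  obtain y where y: "continuous_on {0..T} y"
      "\<And>t. t \<in> {0..T} \<Longrightarrow> y t = z0 + integral {0..t} (\<lambda>s. F u (y s))"
    using volterra_exists[OF lip T] by metis
  \<comment> \<open>Restriction makes the solution extensional without changing the integrals over
    \<open>{0..t}\<close>.\<close>
  define x where "x = restrict y {0..T}"
  have "continuous_on {0..T} x"
    using y(1) by (rule continuous_on_eq) (simp add: x_def)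
  moreover have "x t = z0 + integral {0..t} (\<lambda>s. F u (x s))" if "t \<in> {0..T}" for t
  proof -
    have "integral {0..t} (\<lambda>s. F u (x s)) = integral {0..t} (\<lambda>s. F u (y s))"
      using that by (intro integral_cong) (simp add: x_def)
    then show ?thesis using y(2)[OF that] that by (simp add: x_def)
  qed
  ultimately have x: "solves_system T W z0 u x"
    by (simp add: iff)
  have "w = x" if w: "w \<in> extensional {0..T}" "solves_system T W z0 u w" for w
  proof (rule extensionalityI)
    fix t assume "t \<in> {0..T}"
    then have "norm (w t - x t) \<le> 0"
      using volterra_stability[OF lip cF, of T w x z0 t] x w(2) unfolding iff by auto
    then show "w t = x t" by simp
  qed (use w in \<open>auto simp: x_def\<close>)
  then have "solution T W z0 u = x"
    unfolding solution_def using x by (intro the_equality) (auto simp: x_def)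
  then show "continuous_on {0..T} (solution T W z0 u)"
    and "\<And>t. t \<in> {0..T} \<Longrightarrow> solution T W z0 u t = z0 + integral {0..t} (\<lambda>s. F u (solution T W z0 u s))"
    using x unfolding iff by blast+
qed

section \<open>Convergence of the cost\<close>

text \<open>\<open>L2\<close> refers to the open interval and \<open>cost\<close> to the closed one;
  the two end points form a null set.\<close>

lemma L2_closed_interval:
  assumes "z \<in> L2 T"
  shows "z \<in> borel_measurable (lebesgue_on {0..T})"
    and "integrable (lebesgue_on {0..T}) (\<lambda>t. (norm (z t))\<^sup>2)"
proof -
  have "{0, T} \<inter> {0..T} \<in> null_sets lebesgue"
    using negligible_iff_null_sets negligible_subset[of "{0, T}"] by blast
  then have "{0, T} \<inter> {0..T} \<in> null_sets (lebesgue_on {0..T})"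
    by (subst null_sets_restrict_space) auto
  moreover have "{0..T} - {0, T} \<inter> {0..T} = {0<..<T}" by auto
  ultimately show "z \<in> borel_measurable (lebesgue_on {0..T})"
    using assms borel_measurable_diff_null[of "{0, T} \<inter> {0..T}" "{0..T}" z] by (simp add: L2_def)
  have "(\<lambda>t. (norm (z t))\<^sup>2) absolutely_integrable_on {0<..<T}"
    using assms by (simp add: L2_def set_integrable_def integrable_restrict_space)
  then have "(\<lambda>t. (norm (z t))\<^sup>2) absolutely_integrable_on {0..T}"
    using absolutely_integrable_on_open_interval[where a = 0 and b = T]
    unfolding box_real by blast
  then show "integrable (lebesgue_on {0..T}) (\<lambda>t. (norm (z t))\<^sup>2)"
    by (simp add: set_integrable_def integrable_restrict_space)
qed

text \<open>Dominated convergence: uniformly convergent trajectories are uniformly bounded, and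
  \<open>z\<close> is square-integrable.\<close>

lemma cost_tendsto:
  assumes z: "z \<in> L2 T" and cx: "\<And>m. continuous_on {0..T} (xs m)" "continuous_on {0..T} x"
    and e: "e \<longlonglongrightarrow> 0" and le: "\<And>m t. t \<in> {0..T} \<Longrightarrow> norm (xs m t - x t) \<le> e m"
  shows "(\<lambda>m. cost T z (xs m)) \<longlonglongrightarrow> cost T z x"
proof -
  let ?M = "lebesgue_on {0..T}"
  have m: "y \<in> borel_measurable ?M" if "continuous_on {0..T} y" for y :: "real \<Rightarrow> real^'a^'b"
    using that by (rule continuous_imp_measurable_on_sets_lebesgue) simp
  note [measurable] = L2_closed_interval(1)[OF z] m[OF cx(1)] m[OF cx(2)]
  obtain B where B: "\<And>t. t \<in> {0..T} \<Longrightarrow> norm (x t) \<le> B"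
    using compact_imp_bounded[OF compact_continuous_image[OF cx(2)]] unfolding bounded_iff by force
  obtain E where E: "\<And>m. \<bar>e m\<bar> \<le> E"
    using convergent_imp_Bseq[OF convergentI[OF e]] unfolding Bseq_def by auto
  \<comment> \<open>The trajectories are bounded by \<open>B + E\<close>, and the square of a sum is
    at most twice the sum of the squares.\<close>
  have bound: "(norm (z t - xs m t))\<^sup>2 \<le> 2 * (norm (z t))\<^sup>2 + 2 * (B + E)\<^sup>2" if "t \<in> {0..T}" for m t
  proof -
    have "norm (xs m t) \<le> B + E"
      using norm_triangle_sub[of "xs m t" "x t"] B[OF that] le[OF that, of m] E[of m] by linarith
    then have "norm (z t - xs m t) \<le> norm (z t) + (B + E)"
      using norm_triangle_ineq4[of "z t" "xs m t"] by linarith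
    then have "(norm (z t - xs m t))\<^sup>2 \<le> (norm (z t) + (B + E))\<^sup>2"
      by (intro power_mono) auto
    also have "\<dots> \<le> 2 * (norm (z t))\<^sup>2 + 2 * (B + E)\<^sup>2"
      using sum_squares_bound[of "norm (z t)" "B + E"] by (simp add: power2_sum)
    finally show ?thesis .
  qed
  have lim: "(\<lambda>m. (norm (z t - xs m t))\<^sup>2) \<longlonglongrightarrow> (norm (z t - x t))\<^sup>2" if "t \<in> {0..T}" for t
  proof -
    have "(\<lambda>m. xs m t - x t) \<longlonglongrightarrow> 0"
      using le[OF that] by (intro Lim_null_comparison[OF _ e]) auto
    then have "(\<lambda>m. xs m t) \<longlonglongrightarrow> x t"
      by (rule LIM_zero_cancel)
    then show ?thesis by (intro tendsto_intros)
  qed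
  have "(\<lambda>m. LINT t|?M. (norm (z t - xs m t))\<^sup>2) \<longlonglongrightarrow> (LINT t|?M. (norm (z t - x t))\<^sup>2)"
  proof (rule integral_dominated_convergence)
    show "integrable ?M (\<lambda>t. 2 * (norm (z t))\<^sup>2 + 2 * (B + E)\<^sup>2)"
      by (intro Bochner_Integration.integrable_add integrable_mult_right L2_closed_interval(2)[OF z]
          finite_measure.integrable_const[OF finite_measure_lebesgue_on]) simp
  qed (use bound lim in \<open>auto intro!: AE_I2\<close>)
  then show ?thesis unfolding cost_def by (intro tendsto_intros)
qed

section \<open>Existence of a minimizer\<close>

theorem theorem3:
  fixes L :: nat and n :: "nat \<Rightarrow> nat" and g :: "nat \<Rightarrow> real \<Rightarrow> real"
    and pos :: "'d::finite \<Rightarrow> nat"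
    and W :: "'n::finite \<Rightarrow> 'n \<Rightarrow> weights \<Rightarrow> real^'d \<Rightarrow> real^'d"
    and T :: real and z :: "real \<Rightarrow> real^'d^'n" and z0 :: "real^'d^'n"
  assumes "L \<ge> 2"
    and "n 1 = CARD('d)" and "n L = CARD('d)"
    and "bij_betw pos UNIV {1..CARD('d)}"
    and "T > 0"
    and "\<forall>l\<in>{2..L}. \<exists>C. C-lipschitz_on UNIV (g l)"
    and "z \<in> L2 T"
    and "\<forall>i j. (\<forall>u\<in>weight_space L n. W i j u = network_map pos L n g u)
            \<or> (\<forall>u\<in>weight_space L n. W i j u = (\<lambda>\<xi>. 0))
            \<or> (\<exists>uhat\<in>weight_space L n. \<forall>u\<in>weight_space L n. W i j u = network_map pos L n g uhat)"
    and "\<forall>i j. weakly_continuous_interaction L n T i j (W i j)"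
    and "g L 0 = 0"
  shows "\<exists>ustar\<in>admissible_weights L n. \<forall>u\<in>admissible_weights L n.
           cost T z (solution T W z0 ustar) \<le> cost T z (solution T W z0 u)"
proof -
  define A where "A = admissible_weights L n"
  define F where "F = (\<lambda>u (x :: real^'d^'n). \<chi> i. \<Sum>j\<in>UNIV. W i j u (x $ j - x $ i))"
  have T: "0 \<le> T" using \<open>T > 0\<close> by simp
  note reg = interaction_regular[OF bspec[OF assms(6)] assms(8)[rule_format], folded A_def]
  have cF: "continuous_on (A \<times> UNIV) (\<lambda>(u, x). F u x)"
  proof -
    have "continuous_on (A \<times> UNIV) (\<lambda>p :: weights \<times> (real^'d^'n). case_prod (W i j) (fst p, snd p $ j - snd p $ i))" for i j
    proof (rule continuous_on_compose2[OF reg(1)[of i j], where f = "\<lambda>p. (fst p, snd p $ j - snd p $ i)"])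
      show "continuous_on (A \<times> UNIV) (\<lambda>p :: weights \<times> (real^'d^'n). (fst p, snd p $ j - snd p $ i))"
        by (intro continuous_on_Pair continuous_on_fst continuous_on_snd
          continuous_on_diff continuous_on_component continuous_on_id)
    qed auto
    then show ?thesis
      unfolding F_def case_prod_beta by (intro continuous_on_vec_lambda continuous_on_sum) simp
  qed
  obtain C where C: "\<And>i j u. u \<in> A \<Longrightarrow> (C i j)-lipschitz_on UNIV (W i j u)"
    using reg(2) by metis
  \<comment> \<open>The factor \<open>1 + 1\<close> is the Lipschitz constant of the difference of
    two components of the state.\<close>
  define K where "K = (\<Sum>i\<in>UNIV. \<Sum>j\<in>UNIV. C i j * (1 + 1))"
  have lip: "K-lipschitz_on UNIV (F u)" if "u \<in> A" for u
    unfolding K_def F_def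
  proof (intro lipschitz_on_vec)
    show "(\<Sum>j\<in>UNIV. C i j * (1 + 1))-lipschitz_on UNIV (\<lambda>x :: real^'d^'n. (\<chi> i. \<Sum>j\<in>UNIV. W i j u (x $ j - x $ i)) $ i)" for i
      unfolding vec_lambda_beta
      by (intro lipschitz_on_sum lipschitz_on_compose2 lipschitz_on_diff lipschitz_on_vec_nth
          lipschitz_on_subset[OF C[OF that]] subset_UNIV)
  qed
  let ?x = "solution T W z0"
  have cx: "continuous_on {0..T} (?x u)"
    and x: "\<And>t. t \<in> {0..T} \<Longrightarrow> ?x u t = z0 + integral {0..t} (\<lambda>s. F u (?x u s))" if "u \<in> A" for u
    using solution_volterra[where C = K and W = W and u = u and T = T] lip[OF that] T by (simp_all add: F_def)
  \<comment> \<open>Weights are functions on a countable set, so their product topology is first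
    countable and sequences suffice.\<close>
  have "continuous_on A (\<lambda>u. cost T z (?x u))"
    unfolding continuous_on_sequentially comp_def
  proof (intro allI ballI impI, elim conjE)
    fix us u assume u: "u \<in> A" and us: "\<forall>m. us m \<in> A" "us \<longlonglongrightarrow> u"
    \<comment> \<open>The defect is evaluated along the fixed trajectory of the limit
      \<open>u\<close>. It is an integral over a compact interval with a continuous parameter
      \<open>v\<close>, and it vanishes at \<open>v = u\<close>.\<close>
    define D where "D = (\<lambda>v. integral {0..T} (\<lambda>s. norm (F v (?x u s) - F u (?x u s))))"
    have "continuous_on (A \<times> {0..T}) (\<lambda>p. case_prod F (fst p, ?x u (snd p)))"
      by (rule continuous_on_compose2[OF cF])
        (auto intro!: continuous_on_Pair continuous_on_fst continuous_on_snd continuous_on_id continuous_on_compose2[OF cx[OF u]])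
    moreover have "continuous_on (A \<times> {0..T}) (\<lambda>p. case_prod F (u, ?x u (snd p)))"
      by (rule continuous_on_compose2[OF cF])
        (use u in \<open>auto intro!: continuous_on_Pair continuous_on_const continuous_on_snd continuous_on_id continuous_on_compose2[OF cx[OF u]]\<close>)
    ultimately have "continuous_on A D"
      unfolding D_def cbox_interval[symmetric]
      by (intro integral_continuous_on_param) (auto simp: case_prod_beta intro!: continuous_intros)
    then have "(\<lambda>m. D (us m)) \<longlonglongrightarrow> D u"
      using us u unfolding continuous_on_sequentially comp_def by blast
    then have D: "(\<lambda>m. D (us m)) \<longlonglongrightarrow> 0"
      by (simp add: D_def)
    show "(\<lambda>m. cost T z (?x (us m))) \<longlonglongrightarrow> cost T z (?x u)"
    proof (rule cost_tendsto[OF \<open>z \<in> L2 T\<close>])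
      show "(\<lambda>m. 2 * exp ((2 * K + 1) * T) * D (us m)) \<longlonglongrightarrow> 0"
        using tendsto_mult_right_zero[OF D] by simp
      show "norm (?x (us m) t - ?x u t) \<le> 2 * exp ((2 * K + 1) * T) * D (us m)"
        if "t \<in> {0..T}" for m t
        unfolding D_def using us(1) u that
        \<comment> \<open>Here \<open>F (us m)\<close> takes the role of \<open>f\<close> and
          \<open>F u\<close> that of \<open>h\<close>; the common constant \<open>K\<close> keeps
          the factor before \<open>D (us m)\<close> independent of \<open>m\<close>.\<close>
        by (intro volterra_stability[where ?x0.0 = z0] lip lipschitz_on_continuous_on[OF lip] cx x) auto
    qed (use us u cx in auto)
  qed
  then show ?thesis
    using continuous_attains_inf[OF compact_admissible_weights admissible_weights_nonempty]
    unfolding A_def by blast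
qed

end
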